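(* Let $K\ge 1$ and $1\le n\le K$ be integers, let $p=(p_1,\dots,p_K)$ with $p_i\in(0,1)$ for all $i$, and consider rejective sampling of subsets of $[K]=\{1,\dots,K\}$ of size $n$ with weights $p$. Let $\pi=\mathbb{E}_n[\mathbf{1}_S]\in\mathbb{R}^K$ be the vector of first order inclusion probabilities, $D_\pi$ the $K\times K$ diagonal matrix with $\pi$ on the diagonal, and for $1\le m\le K$ let $\Sigma_m=\mathbb{E}_m[\mathbf{1}_S\mathbf{1}_S^{t}]$ (rejective sampling of sets of size $m$ with the same weights $p$). Then the following hold. (a) If $n<K$, then for every matrix $A\in\mathbb{R}^{K\times K}$, $$\|A\odot\Sigma_n\|\le\frac{1+\|\pi\|_\infty}{(1-\|\pi\|_\infty)^2}\cdot\|D_\pi[A-A\odot\mathbb{I}]D_\pi\|+\|A\odot D_\pi\|.$$ (b) $$\Sigma_n\preceq\pi\pi^{t}+2D_\pi.$$ (c) If $n<K$, then for every $L\subseteq[K]$ with $|L|<n$, setting $\mathcal{L}:=\{I\subseteq[K]:L\subseteq I\}$, $$\mathbb{E}_n\big[\mathbf{1}_{S\setminus L}\mathbf{1}_{S\setminus L}^{t}\cdot\mathbb{1}_{\mathcal{L}}(S)\big]\preceq\Sigma_{n-|L|}\cdot\prod_{\ell\in L}\frac{\pi_\ell}{1-\pi_\ell}.$$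
   Context: Poisson sampling with weights $p_i\in(0,1)$: the random set $S\subseteq[K]$ satisfies $\mathbb{P}(S=I)=\prod_{i\in I}p_i\prod_{j\notin I}(1-p_j)$ for all $I\subseteq[K]$. Rejective sampling with parameter $m$ (and the same weights) is this distribution conditioned on $|S|=m$: $\mathbb{P}_m(S=I)=\mathbb{P}(S=I\mid |S|=m)$, which vanishes unless $|I|=m$; $\mathbb{E}_m$ denotes the corresponding expectation. The weights are not assumed to sum to $n$. For $I\subseteq[K]$, $\mathbf{1}_I\in\{0,1\}^K$ is the indicator vector of $I$. Thus $\pi_i=\mathbb{P}_n(i\in S)$, and $\Sigma_m$ has diagonal entries $\mathbb{P}_m(i\in S)$ and off-diagonal entries $\mathbb{P}_m(\{i,j\}\subseteq S)$. $\mathbb{1}_{\mathcal{L}}(S)$ equals $1$ if $S\in\mathcal{L}$ and $0$ otherwise. $\odot$ is the Hadamard (entrywise) product, $\mathbb{I}$ the identity matrix, $^{t}$ the transpose, $\|\cdot\|$ of a matrix the operator norm induced by the Euclidean norm, and $\|\pi\|_\infty=\max_i\pi_i$. For symmetric matrices, $A\preceq B$ means that $B-A$ is positive semi-definite. *)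

theory Defs
  imports "HOL-Analysis.Analysis" "HOL-Probability.Probability"
begin

text \<open>
  The ground set $[K]$ is the universe of a finite type \<open>'k\<close>, so that $K$ is \<open>CARD('k)\<close>,
  vectors in $\mathbb{R}^K$ have type \<open>real ^ 'k\<close>, and subsets of $[K]$ have type \<open>'k set\<close>.
\<close>

subsection \<open>Poisson and rejective sampling\<close>

text \<open>
  \<open>embed_pmf\<close> is only meaningful for nonnegative weights of total mass 1; see
  \<open>pmf_poisson_sampling\<close> below.
\<close>

definition poisson_sampling :: "real ^ 'k \<Rightarrow> 'k::finite set pmf" where
  "poisson_sampling p = embed_pmf (\<lambda>I. (\<Prod>i\<in>I. p $ i) * (\<Prod>j\<in>-I. 1 - p $ j))"

text \<open>
  \<open>cond_pmf\<close> is only meaningful if the conditioning event has positive probability. For weights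
  in $(0,1)$ this is the case iff \<open>m \<le> CARD('k)\<close>; see \<open>pmf_rejective_sampling\<close> below.
\<close>

definition rejective_sampling :: "real ^ 'k \<Rightarrow> nat \<Rightarrow> 'k::finite set pmf" where
  "rejective_sampling p m = cond_pmf (poisson_sampling p) {I. card I = m}"

subsection \<open>Vectors and matrices\<close>

definition indvec :: "'k set \<Rightarrow> real ^ 'k::finite" where
  "indvec I = (\<chi> i. indicator I i)"

definition outer :: "real ^ 'k \<Rightarrow> real ^ 'k \<Rightarrow> real ^ 'k ^ 'k::finite" where
  "outer u v = (\<chi> i j. u $ i * v $ j)"

definition diag_mat :: "real ^ 'k \<Rightarrow> real ^ 'k ^ 'k::finite" where
  "diag_mat v = (\<chi> i j. if i = j then v $ i else 0)"

definition hadamard :: "real ^ 'k ^ 'k \<Rightarrow> real ^ 'k ^ 'k \<Rightarrow> real ^ 'k ^ 'k::finite"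
    (infixl \<open>\<odot>\<close> 70) where
  "A \<odot> B = (\<chi> i j. A $ i $ j * B $ i $ j)"

text \<open>\<open>norm\<close> on the type \<open>real ^ 'k ^ 'k\<close> is the Frobenius norm, hence the following.\<close>

definition opnorm :: "real ^ 'k ^ 'k::finite \<Rightarrow> real" where
  "opnorm A = onorm (\<lambda>x. A *v x)"

definition pos_semidef :: "real ^ 'k ^ 'k::finite \<Rightarrow> bool" where
  "pos_semidef A \<longleftrightarrow> transpose A = A \<and> (\<forall>x. 0 \<le> x \<bullet> (A *v x))"

definition loewner_le :: "real ^ 'k ^ 'k \<Rightarrow> real ^ 'k ^ 'k::finite \<Rightarrow> bool"
    (infix \<open>\<preceq>\<close> 50) where
  "A \<preceq> B \<longleftrightarrow> pos_semidef (B - A)"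

subsection \<open>Inclusion probabilities\<close>

definition incl_prob :: "real ^ 'k \<Rightarrow> nat \<Rightarrow> real ^ 'k::finite" where
  "incl_prob p m = measure_pmf.expectation (rejective_sampling p m) indvec"

definition incl_matrix :: "real ^ 'k \<Rightarrow> nat \<Rightarrow> real ^ 'k ^ 'k::finite" where
  "incl_matrix p m =
     measure_pmf.expectation (rejective_sampling p m) (\<lambda>S. outer (indvec S) (indvec S))"

subsection \<open>Sanity checks\<close>

lemma sum_poisson_weights:
  fixes p :: "real ^ 'k::finite"
  shows "(\<Sum>I\<in>UNIV. (\<Prod>i\<in>I. p $ i) * (\<Prod>j\<in>-I. 1 - p $ j)) = 1"
  using prod_add[of "UNIV :: 'k set" "\<lambda>i. p $ i" "\<lambda>i. 1 - p $ i"]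
  by (simp add: Compl_eq_Diff_UNIV)

lemma pmf_poisson_sampling:
  fixes p :: "real ^ 'k::finite"
  assumes "\<And>i. 0 < p $ i" "\<And>i. p $ i < 1"
  shows "pmf (poisson_sampling p) I = (\<Prod>i\<in>I. p $ i) * (\<Prod>j\<in>-I. 1 - p $ j)"
  unfolding poisson_sampling_def
proof (rule pmf_embed_pmf)
  show nonneg: "0 \<le> (\<Prod>i\<in>I. p $ i) * (\<Prod>j\<in>-I. 1 - p $ j)" for I
    using assms by (intro mult_nonneg_nonneg prod_nonneg) (auto intro: less_imp_le)
  show "(\<integral>\<^sup>+I. ennreal ((\<Prod>i\<in>I. p $ i) * (\<Prod>j\<in>-I. 1 - p $ j)) \<partial>count_space UNIV) = 1"
    using nonneg by (simp add: nn_integral_count_space_finite sum_poisson_weights)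
qed

lemma pmf_rejective_sampling:
  fixes p :: "real ^ 'k::finite"
  assumes "\<And>i. 0 < p $ i" "\<And>i. p $ i < 1" "m \<le> CARD('k)"
  shows "pmf (rejective_sampling p m) I =
    (if card I = m
     then pmf (poisson_sampling p) I / measure_pmf.prob (poisson_sampling p) {I. card I = m}
     else 0)"
proof -
  obtain J :: "'k set" where J: "card J = m"
    using obtain_subset_with_card_n[OF assms(3)] by blast
  have "0 < pmf (poisson_sampling p) J"
    using assms by (auto simp: pmf_poisson_sampling intro!: mult_pos_pos prod_pos)
  then have "J \<in> set_pmf (poisson_sampling p) \<inter> {I. card I = m}"
    using J by (simp add: set_pmf_iff)
  then have "set_pmf (poisson_sampling p) \<inter> {I. card I = m} \<noteq> {}"
    by blast
  then show ?thesis
    by (simp add: rejective_sampling_def pmf_cond)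
qed

lemma incl_prob_nth:
  "incl_prob p m $ i = measure_pmf.prob (rejective_sampling p m) {S. i \<in> S}"
proof -
  have "incl_prob p m $ i = measure_pmf.expectation (rejective_sampling p m) (\<lambda>S. indvec S $ i)"
    unfolding incl_prob_def
    by (rule integral_bounded_linear[OF bounded_linear_vec_nth, symmetric])
       (simp add: integrable_measure_pmf_finite)
  also have "\<dots> = measure_pmf.expectation (rejective_sampling p m) (indicator {S. i \<in> S})"
    by (intro Bochner_Integration.integral_cong) (auto simp: indvec_def indicator_def)
  finally show ?thesis by simp
qed

lemma incl_matrix_nth:
  "incl_matrix p m $ i $ j = measure_pmf.prob (rejective_sampling p m) {S. {i, j} \<subseteq> S}"
proof -
  have "incl_matrix p m $ i $ j =
      measure_pmf.expectation (rejective_sampling p m) (\<lambda>S. outer (indvec S) (indvec S) $ i $ j)"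
    unfolding incl_matrix_def
    by (rule integral_bounded_linear[where T = "\<lambda>A. A $ i $ j", symmetric])
       (auto simp: integrable_measure_pmf_finite
             intro: bounded_linear_compose[OF bounded_linear_vec_nth bounded_linear_vec_nth])
  also have "\<dots> =
      measure_pmf.expectation (rejective_sampling p m) (indicator {S. {i, j} \<subseteq> S})"
    by (intro Bochner_Integration.integral_cong)
       (auto simp: outer_def indvec_def indicator_def)
  finally show ?thesis by simp
qed

end

theory Submission
  imports Defs
begin

text \<open>
  With the odds $\theta_i = p_i/(1-p_i)$, rejective sampling of size $m$ gives $S$ probability
  $\prod_{i\in S}\theta_i / e_m$, where $e_m$ is the elementary symmetric polynomial of the odds.
  All three parts rest on the log-concavity of $m \mapsto e_m$.

  For (a), the off-diagonal part of $\pi_{ij}/(\pi_i\pi_j)$ agrees with that of a positive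
  semi-definite matrix, a positive combination of the matrices $a_T a_T^t$ with $|T| = n-2$ and
  $a_T(i) = (\theta_i/\pi_i)\,1_{i\notin T}$. Schur multiplication by it has norm at most its
  largest diagonal entry, which log-concavity bounds by $1/(1-\|\pi\|_\infty)$.
  For (b), $\pi\pi^t + 2D_\pi - \Sigma_n$ is diagonally dominant, because inclusions are negatively
  correlated and the rows of the covariance matrix sum to zero.
  For (c), the left-hand side is $\prod_{l\in L}\theta_l/e_n$ times a part of the sum that defines
  $e_{n-|L|}\Sigma_{n-|L|}$, and log-concavity compares the constants.
\<close>

section \<open>Elementary symmetric polynomials\<close>

definition esym :: "('a \<Rightarrow> real) \<Rightarrow> 'a set \<Rightarrow> nat \<Rightarrow> real" where
  "esym \<theta> A k = (\<Sum>T | T \<subseteq> A \<and> card T = k. \<Prod>i\<in>T. \<theta> i)"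

lemma esym_nonneg: "(\<And>i. i \<in> A \<Longrightarrow> 0 \<le> \<theta> i) \<Longrightarrow> 0 \<le> esym \<theta> A k"
  unfolding esym_def by (intro sum_nonneg prod_nonneg) auto

lemma esym_pos:
  assumes "finite A" "\<And>i. i \<in> A \<Longrightarrow> 0 < \<theta> i" "k \<le> card A"
  shows "0 < esym \<theta> A k"
proof -
  have "{T. T \<subseteq> A \<and> card T = k} \<noteq> {}"
    using obtain_subset_with_card_n[OF assms(3)] by blast
  then show ?thesis
    unfolding esym_def using assms by (intro sum_pos prod_pos) auto
qed

lemma esym_0: "finite A \<Longrightarrow> esym \<theta> A 0 = 1"
proof -
  assume "finite A"
  then have "{T. T \<subseteq> A \<and> card T = 0} = {{}}"
    by (auto dest: finite_subset)
  then show ?thesis by (simp add: esym_def)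
qed

text \<open>The subsets of size \<open>Suc k\<close> split into those that avoid \<open>i\<close>
  and those of the form \<open>insert i T\<close> with \<open>T\<close> of size
  \<open>k\<close>.\<close>

lemma esym_insert:
  assumes "finite A" "i \<notin> A"
  shows "esym \<theta> (insert i A) (Suc k) = esym \<theta> A (Suc k) + \<theta> i * esym \<theta> A k"
proof -
  let ?U = "{T. T \<subseteq> A \<and> card T = Suc k}" and ?V = "{T. T \<subseteq> A \<and> card T = k}"
  have fin: "finite T" if "T \<subseteq> A" for T using that assms(1) by (rule finite_subset)
  have eq: "{T. T \<subseteq> insert i A \<and> card T = Suc k} = ?U \<union> insert i ` ?V"
  proof (intro equalityI subsetI)
    fix T assume T: "T \<in> {T. T \<subseteq> insert i A \<and> card T = Suc k}"
    show "T \<in> ?U \<union> insert i ` ?V"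
    proof (cases "i \<in> T")
      case True
      then have "T = insert i (T - {i})" "T - {i} \<in> ?V" using T by auto
      then show ?thesis by blast
    qed (use T in auto)
  qed (use assms fin in \<open>auto simp: card_insert_if\<close>)
  have inj: "inj_on (insert i) ?V"
    using assms(2) by (intro inj_onI) (metis (mono_tags) insert_ident mem_Collect_eq subsetD)
  have "(\<Sum>T\<in>insert i ` ?V. prod \<theta> T) = (\<Sum>T\<in>?V. \<theta> i * prod \<theta> T)"
    unfolding sum.reindex[OF inj] comp_def
    using assms fin by (intro sum.cong refl prod.insert) auto
  moreover have "?U \<inter> insert i ` ?V = {}" using assms(2) by auto
  ultimately show ?thesis
    unfolding esym_def eq using assms(1) by (simp add: sum.union_disjoint sum_distrib_left)
qed

lemma esym_remove:
  assumes "finite A" "i \<in> A"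
  shows "esym \<theta> A (Suc k) = esym \<theta> (A - {i}) (Suc k) + \<theta> i * esym \<theta> (A - {i}) k"
  using esym_insert[of "A - {i}" i \<theta> k] assms by (simp add: insert_absorb)

text \<open>Induction on \<open>A\<close>: after expanding with \<open>esym_insert\<close>, the
  coefficients of 1, \<open>\<theta> x\<close> and its square are compared one by one. Two indices
  \<open>i \<le> j\<close> are needed because the linear coefficient pairs indices that are further
  apart than those of the claim. Products instead of ratios also cover indices beyond
  \<open>card A\<close>, where \<open>esym\<close> vanishes.\<close>

lemma esym_log_concave:
  assumes "finite A" "\<And>i. i \<in> A \<Longrightarrow> 0 \<le> \<theta> i" "i \<le> j"
  shows "esym \<theta> A i * esym \<theta> A (Suc j) \<le> esym \<theta> A (Suc i) * esym \<theta> A j"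
  using assms
proof (induction A arbitrary: i j rule: finite_induct)
  case empty
  have "esym \<theta> {} (Suc j) = 0" for j by (auto simp: esym_def)
  then show ?case by simp
next
  case (insert x A)
  let ?e = "esym \<theta> A"
  have nn: "0 \<le> ?e k" for k using insert.prems by (intro esym_nonneg) auto
  have x: "0 \<le> \<theta> x" using insert.prems by simp
  have IH: "?e k * ?e (Suc l) \<le> ?e (Suc k) * ?e l" if "k \<le> l" for k l
    using that insert by auto
  note ins = esym_insert[OF insert.hyps(1,2)]
  show ?case
  proof (cases j)
    case 0
    then show ?thesis using insert.prems by (simp add: mult.commute)
  next
    case (Suc j')
    show ?thesis
    proof (cases i)
      \<comment> \<open>There is no term of index \<open>i - 1\<close> here. The expansion of the
        right-hand side has two extra terms, both nonnegative.\<close>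
      case 0
      have "?e 0 * ?e (Suc j) \<le> ?e 1 * ?e j" using IH[of 0 j] by simp
      moreover have "0 \<le> ?e 1 * \<theta> x * ?e j'" "0 \<le> \<theta> x * \<theta> x * ?e j'" using nn x by simp_all
      ultimately show ?thesis
        using insert.hyps by (simp add: 0 Suc ins esym_0 algebra_simps)
    next
      case (Suc i')
      have le: "Suc i' \<le> Suc j'" using insert.prems Suc \<open>j = Suc j'\<close> by simp
      have a: "?e (Suc i') * ?e (Suc (Suc j')) \<le> ?e (Suc (Suc i')) * ?e (Suc j')"
        using IH le by blast
      have b: "?e i' * ?e (Suc j') \<le> ?e (Suc i') * ?e j'"
        using IH le by simp
      \<comment> \<open>Both indices move inward by one step, through the product of the entries at
        \<open>Suc i'\<close> and \<open>Suc j'\<close>. The second move needs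
        \<open>Suc i' \<le> j'\<close>; for \<open>i' = j'\<close> the two sides coincide.\<close>
      have c: "?e i' * ?e (Suc (Suc j')) \<le> ?e (Suc (Suc i')) * ?e j'"
      proof (cases "i' = j'")
        case False
        have "?e i' * ?e (Suc (Suc j')) \<le> ?e (Suc i') * ?e (Suc j')"
          using IH[of i' "Suc j'"] le by simp
        also have "\<dots> \<le> ?e (Suc (Suc i')) * ?e j'"
          using IH[of "Suc i'" j'] le False by simp
        finally show ?thesis .
      qed (simp add: mult.commute)
      have "\<theta> x * (?e i' * ?e (Suc (Suc j'))) \<le> \<theta> x * (?e (Suc (Suc i')) * ?e j')"
        "\<theta> x * \<theta> x * (?e i' * ?e (Suc j')) \<le> \<theta> x * \<theta> x * (?e (Suc i') * ?e j')"
        using b c x by (simp_all add: mult_left_mono)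
      with a show ?thesis
        by (simp add: \<open>j = Suc j'\<close> Suc ins algebra_simps)
    qed
  qed
qed

text \<open>Expanding \<open>esym \<theta> A\<close> by \<open>esym_remove\<close> on both sides,
  the common product cancels, and \<open>\<theta> i\<close> times log-concavity on
  \<open>A - {i}\<close> remains. In terms of ratios, removing an element can only increase e_k /
  e_(k+1).\<close>

lemma esym_ratio_remove:
  assumes "finite A" "\<And>i. i \<in> A \<Longrightarrow> 0 \<le> \<theta> i" "i \<in> A"
  shows "esym \<theta> A k * esym \<theta> (A - {i}) (Suc k) \<le> esym \<theta> (A - {i}) k * esym \<theta> A (Suc k)"
proof (cases k)
  case 0
  then show ?thesis
    using assms by (simp add: esym_0 esym_remove)
next
  case (Suc l)
  have "esym \<theta> (A - {i}) l * esym \<theta> (A - {i}) (Suc k)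
      \<le> esym \<theta> (A - {i}) k * esym \<theta> (A - {i}) k"
    using esym_log_concave[of "A - {i}" \<theta> l k] assms Suc by simp
  then have "\<theta> i * (esym \<theta> (A - {i}) l * esym \<theta> (A - {i}) (Suc k))
      \<le> \<theta> i * (esym \<theta> (A - {i}) k * esym \<theta> (A - {i}) k)"
    using assms by (intro mult_left_mono) auto
  then show ?thesis
    using esym_remove[OF assms(1,3), of \<theta> k] esym_remove[OF assms(1,3), of \<theta> l] Suc
    by (simp add: algebra_simps)
qed

text \<open>The left-hand side is a product of \<open>l\<close> consecutive ratios e_k / e_(k+1). By
  log-concavity these increase with k, so each is at most the last one.\<close>

lemma esym_ratio_power:
  assumes "finite A" "\<And>i. i \<in> A \<Longrightarrow> 0 < \<theta> i" "l \<le> n" "n \<le> card A" "1 \<le> n"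
  shows "esym \<theta> A (n - l) / esym \<theta> A n \<le> (esym \<theta> A (n - 1) / esym \<theta> A n) ^ l"
  using assms(3)
proof (induction l)
  case 0
  then show ?case using esym_pos[OF assms(1,2,4)] by simp
next
  case (Suc l)
  let ?e = "esym \<theta> A"
  define k where "k = n - Suc l"
  have k: "n - l = Suc k" "n - Suc l = k" "k \<le> n - 1" "Suc (n - 1) = n"
    using Suc.prems assms(5) by (auto simp: k_def)
  have pos: "0 < ?e n" "0 < ?e (Suc k)" "0 < ?e k"
    using k assms by (auto intro!: esym_pos)
  have "?e k * ?e n \<le> ?e (Suc k) * ?e (n - 1)"
    using esym_log_concave[of A \<theta> k "n - 1"] assms(1,2) k by (simp add: less_imp_le)
  then have "?e k / ?e n \<le> (?e (n - 1) / ?e n) * (?e (Suc k) / ?e n)"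
    using pos by (simp add: field_simps)
  also have "\<dots> \<le> (?e (n - 1) / ?e n) * (?e (n - 1) / ?e n) ^ l"
    using Suc.IH Suc.prems k pos assms(1,2)
    by (intro mult_left_mono divide_nonneg_pos esym_nonneg) (auto intro: less_imp_le)
  finally show ?case by (simp add: k)
qed

text \<open>Reindexing by \<open>S - L\<close>. A vector-valued \<open>f\<close> lets the identity
  serve both for probabilities and for the matrix expectation in (c).\<close>

lemma sum_weight_superset:
  fixes f :: "'a::finite set \<Rightarrow> 'b::real_vector"
  shows "(\<Sum>S | L \<subseteq> S \<and> card S = k + card L. prod \<theta> S *\<^sub>R f S) =
    prod \<theta> L *\<^sub>R (\<Sum>T | T \<subseteq> - L \<and> card T = k. prod \<theta> T *\<^sub>R f (T \<union> L))"
proof -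
  have "(\<Sum>S | L \<subseteq> S \<and> card S = k + card L. prod \<theta> S *\<^sub>R f S) =
      (\<Sum>T | T \<subseteq> - L \<and> card T = k. prod \<theta> (T \<union> L) *\<^sub>R f (T \<union> L))"
  proof (rule sum.reindex_bij_witness[of _ "\<lambda>T. T \<union> L" "\<lambda>S. S - L"])
    fix S assume "S \<in> {S. L \<subseteq> S \<and> card S = k + card L}"
    then show "S - L \<in> {T. T \<subseteq> - L \<and> card T = k}" "S - L \<union> L = S"
      "prod \<theta> (S - L \<union> L) *\<^sub>R f (S - L \<union> L) = prod \<theta> S *\<^sub>R f S"
      by (auto simp: card_Diff_subset Un_absorb2)
  next
    fix T assume "T \<in> {T. T \<subseteq> - L \<and> card T = k}"
    then have T: "T \<inter> L = {}" "card T = k" by auto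
    show "T \<union> L - L = T" "T \<union> L \<in> {S. L \<subseteq> S \<and> card S = k + card L}"
      using T by (auto simp: card_Un_disjoint)
  qed
  also have "\<dots> = (\<Sum>T | T \<subseteq> - L \<and> card T = k. prod \<theta> L *\<^sub>R prod \<theta> T *\<^sub>R f (T \<union> L))"
  proof (intro sum.cong refl)
    fix T assume "T \<in> {T. T \<subseteq> - L \<and> card T = k}"
    then have "T \<inter> L = {}" by auto
    then have "prod \<theta> (T \<union> L) = prod \<theta> L * prod \<theta> T"
      by (simp add: prod.union_disjoint mult.commute)
    then show "prod \<theta> (T \<union> L) *\<^sub>R f (T \<union> L) = prod \<theta> L *\<^sub>R prod \<theta> T *\<^sub>R f (T \<union> L)"
      by simp
  qed
  finally show ?thesis by (simp add: scaleR_sum_right)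
qed


section \<open>Operator norms and quadratic forms\<close>

lemma opnorm_triangle: "opnorm (A + B) \<le> opnorm A + opnorm B"
  unfolding opnorm_def matrix_vector_mult_add_rdistrib
  by (intro onorm_triangle) (simp_all add: matrix_vector_mul_bounded_linear)

lemma norm_matrix_vector_le_opnorm: "norm (A *v x) \<le> opnorm A * norm x"
  unfolding opnorm_def by (rule onorm[OF matrix_vector_mul_bounded_linear])

lemma opnorm_nonneg: "0 \<le> opnorm A"
  unfolding opnorm_def by (rule onorm_pos_le[OF matrix_vector_mul_bounded_linear])

lemma opnorm_leI:
  assumes "0 \<le> c" "\<And>x y. y \<bullet> (A *v x) \<le> c * norm y * norm x"
  shows "opnorm A \<le> c"
  unfolding opnorm_def
proof (rule onorm_bound[OF assms(1)])
  fix x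
  show "norm (A *v x) \<le> c * norm x"
  proof (cases "A *v x = 0")
    case False
    have "norm (A *v x) * norm (A *v x) \<le> norm (A *v x) * (c * norm x)"
      using assms(2)[of "A *v x" x]
      by (simp add: power2_norm_eq_inner[symmetric] power2_eq_square mult_ac)
    then show ?thesis using False by simp
  qed (use assms in simp)
qed

lemma inner_matrix_vector_sum:
  "y \<bullet> (A *v x) = (\<Sum>i\<in>UNIV. \<Sum>j\<in>UNIV. y $ i * A $ i $ j * x $ j)"
  by (simp add: inner_vec_def matrix_vector_mult_def sum_distrib_left mult.assoc)

text \<open>Schur's bound for Hadamard multipliers, with the positive semi-definite factor given as
  a Gram sum so that no matrix square root is required. The bilinear form of the product is the
  weighted sum over \<open>t\<close> of the forms of \<open>B\<close> at \<open>m y t\<close> and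
  \<open>m x t\<close>. Cauchy-Schwarz over \<open>t\<close> separates \<open>y\<close> from
  \<open>x\<close>, and each factor is controlled by the diagonal of the Gram matrix.\<close>

lemma opnorm_hadamard_gram_le:
  fixes a :: "'t \<Rightarrow> real ^ 'k::finite"
  assumes "\<And>t. t \<in> F \<Longrightarrow> 0 \<le> w t" "0 \<le> c"
    and "\<And>i. (\<Sum>t\<in>F. w t * (a t $ i)\<^sup>2) \<le> c"
  shows "opnorm (B \<odot> (\<Sum>t\<in>F. w t *\<^sub>R outer (a t) (a t))) \<le> c * opnorm B"
proof (rule opnorm_leI)
  show "0 \<le> c * opnorm B" by (intro mult_nonneg_nonneg assms(2) opnorm_nonneg)
  fix x y :: "real ^ 'k"
  define m where "m z t = (\<chi> i. a t $ i * z $ i)" for z :: "real ^ 'k" and t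
  have m_bound: "(\<Sum>t\<in>F. (sqrt (w t) * norm (m z t))\<^sup>2) \<le> c * (norm z)\<^sup>2" for z
  proof -
    have "(\<Sum>t\<in>F. (sqrt (w t) * norm (m z t))\<^sup>2) =
        (\<Sum>t\<in>F. \<Sum>i\<in>UNIV. w t * (a t $ i)\<^sup>2 * (z $ i)\<^sup>2)"
    proof (intro sum.cong refl)
      fix t assume "t \<in> F"
      then have "(sqrt (w t) * norm (m z t))\<^sup>2 = w t * (m z t \<bullet> m z t)"
        by (simp add: assms(1) power_mult_distrib power2_norm_eq_inner)
      then show "(sqrt (w t) * norm (m z t))\<^sup>2 = (\<Sum>i\<in>UNIV. w t * (a t $ i)\<^sup>2 * (z $ i)\<^sup>2)"
        by (simp add: inner_vec_def m_def sum_distrib_left power2_eq_square mult_ac)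
    qed
    also have "\<dots> = (\<Sum>i\<in>UNIV. (\<Sum>t\<in>F. w t * (a t $ i)\<^sup>2) * (z $ i)\<^sup>2)"
      by (subst sum.swap) (simp add: sum_distrib_right)
    also have "\<dots> \<le> (\<Sum>i\<in>UNIV. c * (z $ i)\<^sup>2)"
      by (intro sum_mono mult_right_mono assms(3)) simp
    also have "\<dots> = c * (norm z)\<^sup>2"
      unfolding power2_norm_eq_inner by (simp add: inner_vec_def sum_distrib_left power2_eq_square)
    finally show ?thesis .
  qed
  have "y \<bullet> ((B \<odot> (\<Sum>t\<in>F. w t *\<^sub>R outer (a t) (a t))) *v x) =
      (\<Sum>i\<in>UNIV. \<Sum>j\<in>UNIV. \<Sum>t\<in>F. w t * (m y t $ i * B $ i $ j * m x t $ j))"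
    by (simp add: inner_matrix_vector_sum hadamard_def outer_def m_def sum_distrib_left
        sum_distrib_right mult_ac)
  also have "\<dots> = (\<Sum>i\<in>UNIV. \<Sum>t\<in>F. \<Sum>j\<in>UNIV. w t * (m y t $ i * B $ i $ j * m x t $ j))"
    by (intro sum.cong refl sum.swap)
  also have "\<dots> = (\<Sum>t\<in>F. w t * (m y t \<bullet> (B *v m x t)))"
    by (subst sum.swap) (simp add: inner_matrix_vector_sum sum_distrib_left)
  also have "\<dots> \<le> (\<Sum>t\<in>F. w t * (norm (m y t) * (opnorm B * norm (m x t))))"
    by (intro sum_mono mult_left_mono order_trans[OF norm_cauchy_schwarz] assms(1)
        norm_matrix_vector_le_opnorm) auto
  also have "\<dots> = opnorm B * (\<Sum>t\<in>F. (sqrt (w t) * norm (m y t)) * (sqrt (w t) * norm (m x t)))"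
    unfolding sum_distrib_left
  proof (intro sum.cong refl)
    fix t assume "t \<in> F"
    then have sqrt_sqrt: "sqrt (w t) * (sqrt (w t) * z) = w t * z" for z
      using assms(1) by (simp add: mult.assoc[symmetric])
    show "w t * (norm (m y t) * (opnorm B * norm (m x t))) =
        opnorm B * (sqrt (w t) * norm (m y t) * (sqrt (w t) * norm (m x t)))"
      by (simp only: mult_ac sqrt_sqrt)
  qed
  also have "\<dots> \<le> opnorm B * (sqrt (c * (norm y)\<^sup>2) * sqrt (c * (norm x)\<^sup>2))"
  proof (intro mult_left_mono opnorm_nonneg)
    have "(\<Sum>t\<in>F. (sqrt (w t) * norm (m y t)) * (sqrt (w t) * norm (m x t)))
        \<le> (\<Sum>t\<in>F. \<bar>sqrt (w t) * norm (m y t)\<bar> * \<bar>sqrt (w t) * norm (m x t)\<bar>)"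
      by (intro sum_mono) (simp add: abs_mult[symmetric])
    also have "\<dots> \<le> L2_set (\<lambda>t. sqrt (w t) * norm (m y t)) F * L2_set (\<lambda>t. sqrt (w t) * norm (m x t)) F"
      by (rule L2_set_mult_ineq)
    also have "\<dots> \<le> sqrt (c * (norm y)\<^sup>2) * sqrt (c * (norm x)\<^sup>2)"
      using assms(2) unfolding L2_set_def
      by (intro mult_mono real_sqrt_le_mono m_bound real_sqrt_ge_zero sum_nonneg) auto
    finally show "(\<Sum>t\<in>F. (sqrt (w t) * norm (m y t)) * (sqrt (w t) * norm (m x t)))
        \<le> sqrt (c * (norm y)\<^sup>2) * sqrt (c * (norm x)\<^sup>2)" .
  qed
  also have "\<dots> = c * opnorm B * norm y * norm x"
    using assms(2) by (simp add: real_sqrt_mult mult_ac)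
  finally show "y \<bullet> ((B \<odot> (\<Sum>t\<in>F. w t *\<^sub>R outer (a t) (a t))) *v x)
      \<le> c * opnorm B * norm y * norm x" .
qed

text \<open>Each off-diagonal term is bounded below through 2|x_i x_j| \<le> x_i^2 + x_j^2. By
  symmetry the two squares contribute equally to the double sum, so the total loss at x_i^2 is the
  off-diagonal row sum, which the diagonal entry covers.\<close>

lemma pos_semidef_diag_dominant:
  fixes M :: "real ^ 'k ^ 'k::finite"
  assumes sym: "\<And>i j. M $ i $ j = M $ j $ i"
    and dom: "\<And>i. (\<Sum>j\<in>UNIV - {i}. \<bar>M $ i $ j\<bar>) \<le> M $ i $ i"
  shows "pos_semidef M"
  unfolding pos_semidef_def
proof (intro conjI allI)
  show "transpose M = M" using sym by (simp add: transpose_def vec_eq_iff)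
  fix x :: "real ^ 'k"
  define N where "N i j = (if i = j then 0 else \<bar>M $ i $ j\<bar>)" for i j
  have N_sum: "(\<Sum>j\<in>UNIV. N i j) \<le> M $ i $ i" for i
  proof -
    have "(\<Sum>j\<in>UNIV. N i j) = (\<Sum>j\<in>UNIV - {i}. \<bar>M $ i $ j\<bar>)"
      by (intro sum.mono_neutral_cong_right) (auto simp: N_def)
    then show ?thesis using dom by simp
  qed
  have N_sym: "N i j = N j i" for i j by (simp add: N_def sym)
  have diag: "(\<Sum>j\<in>UNIV. if i = j then M $ i $ i * (x $ i)\<^sup>2 else 0) = M $ i $ i * (x $ i)\<^sup>2" for i
    by simp
  have "(\<Sum>i\<in>UNIV. \<Sum>j\<in>UNIV. N i j * (x $ j)\<^sup>2) = (\<Sum>i\<in>UNIV. \<Sum>j\<in>UNIV. N i j * (x $ i)\<^sup>2)"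
    by (subst sum.swap) (simp add: N_sym)
  then have "(\<Sum>i\<in>UNIV. \<Sum>j\<in>UNIV. (N i j * (x $ i)\<^sup>2 + N i j * (x $ j)\<^sup>2) / 2) =
      (\<Sum>i\<in>UNIV. \<Sum>j\<in>UNIV. N i j * (x $ i)\<^sup>2)"
    by (simp add: sum.distrib sum_divide_distrib[symmetric])
  also have "\<dots> \<le> (\<Sum>i\<in>UNIV. M $ i $ i * (x $ i)\<^sup>2)"
    unfolding sum_distrib_right[symmetric] by (intro sum_mono mult_right_mono N_sum) simp
  finally have "0 \<le> (\<Sum>i\<in>UNIV. M $ i $ i * (x $ i)\<^sup>2) -
      (\<Sum>i\<in>UNIV. \<Sum>j\<in>UNIV. (N i j * (x $ i)\<^sup>2 + N i j * (x $ j)\<^sup>2) / 2)" by simp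
  also have "\<dots> = (\<Sum>i\<in>UNIV. \<Sum>j\<in>UNIV. (if i = j then M $ i $ i * (x $ i)\<^sup>2 else 0) -
      (N i j * (x $ i)\<^sup>2 + N i j * (x $ j)\<^sup>2) / 2)"
    by (simp only: sum_subtractf diag)
  also have "\<dots> \<le> x \<bullet> (M *v x)"
    unfolding inner_matrix_vector_sum
  proof (intro sum_mono)
    fix i j
    have "\<bar>M $ i $ j\<bar> * (2 * \<bar>x $ i * x $ j\<bar>) \<le> \<bar>M $ i $ j\<bar> * ((x $ i)\<^sup>2 + (x $ j)\<^sup>2)"
      using sum_squares_bound[of "\<bar>x $ i\<bar>" "\<bar>x $ j\<bar>"]
      by (intro mult_left_mono) (auto simp: abs_mult)
    moreover have "- (\<bar>M $ i $ j\<bar> * \<bar>x $ i * x $ j\<bar>) \<le> x $ i * M $ i $ j * x $ j"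
      using abs_ge_minus_self[of "M $ i $ j * (x $ i * x $ j)"] by (simp add: abs_mult mult_ac)
    ultimately have "- ((\<bar>M $ i $ j\<bar> * (x $ i)\<^sup>2 + \<bar>M $ i $ j\<bar> * (x $ j)\<^sup>2) / 2) \<le>
        x $ i * M $ i $ j * x $ j"
      unfolding distrib_left[symmetric] by linarith
    then show "(if i = j then M $ i $ i * (x $ i)\<^sup>2 else 0) -
        (N i j * (x $ i)\<^sup>2 + N i j * (x $ j)\<^sup>2) / 2 \<le> x $ i * M $ i $ j * x $ j"
      by (cases "i = j") (simp_all add: N_def power2_eq_square)
  qed
  finally show "0 \<le> x \<bullet> (M *v x)" .
qed

lemma pos_semidef_scaleR: "0 \<le> c \<Longrightarrow> pos_semidef A \<Longrightarrow> pos_semidef (c *\<^sub>R A)"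
  by (simp add: pos_semidef_def transpose_scalar scaleR_matrix_vector_assoc[symmetric])

lemma pos_semidef_add: "pos_semidef A \<Longrightarrow> pos_semidef B \<Longrightarrow> pos_semidef (A + B)"
  by (simp add: pos_semidef_def transpose_def vec_eq_iff matrix_vector_mult_add_rdistrib inner_add_right)

lemma pos_semidef_0: "pos_semidef 0"
  by (simp add: pos_semidef_def transpose_def vec_eq_iff)

lemma pos_semidef_sum: "(\<And>t. t \<in> F \<Longrightarrow> pos_semidef (A t)) \<Longrightarrow> pos_semidef (\<Sum>t\<in>F. A t)"
  by (induction F rule: infinite_finite_induct) (auto intro: pos_semidef_0 pos_semidef_add)

lemma pos_semidef_outer: "pos_semidef (outer u u)"
proof -
  have "x \<bullet> (outer u u *v x) = (u \<bullet> x) * (u \<bullet> x)" for x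
    unfolding inner_matrix_vector_sum by (simp add: outer_def inner_vec_def sum_product mult_ac)
  then show ?thesis
    by (simp add: pos_semidef_def transpose_def outer_def vec_eq_iff mult.commute)
qed


section \<open>Rejective sampling\<close>

context
  fixes p :: "real ^ 'k::finite"
  assumes p_pos: "\<And>i. 0 < p $ i" and p_less_1: "\<And>i. p $ i < 1"
begin

definition odds :: "'k \<Rightarrow> real" where
  "odds i = p $ i / (1 - p $ i)"

lemma odds_pos: "0 < odds i"
  using p_pos p_less_1 by (simp add: odds_def)

lemma esym_odds_nonneg: "0 \<le> esym odds A k"
  using odds_pos by (intro esym_nonneg less_imp_le)

lemma esym_odds_pos: "k \<le> card A \<Longrightarrow> 0 < esym odds A k"
  using odds_pos by (intro esym_pos) auto

text \<open>The factor in front of \<open>prod odds I\<close> is the same for all \<open>I\<close>,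
  so it cancels when conditioning on the size.\<close>

lemma pmf_poisson_odds: "pmf (poisson_sampling p) I = (\<Prod>i\<in>UNIV. 1 - p $ i) * prod odds I"
proof -
  have "(\<Prod>i\<in>I. p $ i) = (\<Prod>i\<in>I. (1 - p $ i)) * prod odds I"
    unfolding prod.distrib[symmetric] odds_def
    using p_less_1 by (intro prod.cong refl) (simp add: less_imp_neq[THEN not_sym])
  moreover have "(\<Prod>i\<in>UNIV. 1 - p $ i) = (\<Prod>i\<in>I. 1 - p $ i) * (\<Prod>i\<in>-I. 1 - p $ i)"
    using prod.union_disjoint[of I "- I" "\<lambda>i. 1 - p $ i"] by simp
  ultimately show ?thesis
    using p_pos p_less_1 by (simp add: pmf_poisson_sampling mult_ac)
qed

lemma pmf_rejective_odds:
  assumes "m \<le> CARD('k)"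
  shows "pmf (rejective_sampling p m) I = (if card I = m then prod odds I / esym odds UNIV m else 0)"
proof -
  have "measure_pmf.prob (poisson_sampling p) {I. card I = m} =
      (\<Prod>i\<in>UNIV. 1 - p $ i) * esym odds UNIV m"
    by (simp add: measure_measure_pmf_finite pmf_poisson_odds esym_def sum_distrib_left)
  moreover have "0 < (\<Prod>i\<in>UNIV. 1 - p $ i)"
    using p_less_1 by (intro prod_pos) simp
  ultimately show ?thesis
    using assms by (simp add: pmf_rejective_sampling[OF p_pos p_less_1] pmf_poisson_odds del: prod_zero_iff)
qed

lemma expectation_rejective:
  fixes f :: "'k set \<Rightarrow> 'b::{banach, second_countable_topology}"
  assumes "m \<le> CARD('k)"
  shows "measure_pmf.expectation (rejective_sampling p m) f =
    (1 / esym odds UNIV m) *\<^sub>R (\<Sum>S | card S = m. prod odds S *\<^sub>R f S)"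
proof -
  have "measure_pmf.expectation (rejective_sampling p m) f =
      (\<Sum>S | card S = m. pmf (rejective_sampling p m) S *\<^sub>R f S)"
    using assms by (intro integral_measure_pmf) (auto simp: set_pmf_iff pmf_rejective_odds split: if_splits)
  then show ?thesis
    using assms by (simp add: pmf_rejective_odds scaleR_sum_right)
qed

text \<open>Common source of the first and second order inclusion probabilities and of the left-hand
  side of (c). Writing the size as \<open>m + card L\<close> avoids truncated subtraction.\<close>

lemma expectation_rejective_superset:
  fixes f :: "'k set \<Rightarrow> 'b::{banach, second_countable_topology}"
  assumes "m + card L \<le> CARD('k)"
  shows "measure_pmf.expectation (rejective_sampling p (m + card L)) (\<lambda>S. indicator {I. L \<subseteq> I} S *\<^sub>R f S) =
    (prod odds L / esym odds UNIV (m + card L)) *\<^sub>R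
      (\<Sum>T | T \<subseteq> - L \<and> card T = m. prod odds T *\<^sub>R f (T \<union> L))"
proof -
  have "(\<Sum>S | card S = m + card L. prod odds S *\<^sub>R indicator {I. L \<subseteq> I} S *\<^sub>R f S) =
      (\<Sum>S | L \<subseteq> S \<and> card S = m + card L. prod odds S *\<^sub>R f S)"
    by (intro sum.mono_neutral_cong_right) (auto simp: indicator_def)
  then show ?thesis
    using assms by (simp add: expectation_rejective sum_weight_superset)
qed

lemma prob_superset_rejective:
  assumes "m + card L \<le> CARD('k)"
  shows "measure_pmf.prob (rejective_sampling p (m + card L)) {S. L \<subseteq> S} =
    prod odds L * esym odds (- L) m / esym odds UNIV (m + card L)"
  using expectation_rejective_superset[OF assms, of "\<lambda>_. 1 :: real"]
  by (simp add: esym_def)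

lemma incl_prob_Suc:
  assumes "Suc m \<le> CARD('k)"
  shows "incl_prob p (Suc m) $ i = odds i * esym odds (- {i}) m / esym odds UNIV (Suc m)"
  using prob_superset_rejective[of m "{i}"] assms by (simp add: incl_prob_nth)

lemma one_minus_incl_prob_Suc:
  assumes "Suc m \<le> CARD('k)"
  shows "1 - incl_prob p (Suc m) $ i = esym odds (- {i}) (Suc m) / esym odds UNIV (Suc m)"
  using assms esym_odds_pos[of "Suc m" UNIV] esym_remove[of UNIV i odds m]
  by (simp add: incl_prob_Suc field_simps Compl_eq_Diff_UNIV)

lemma incl_matrix_diag: "incl_matrix p m $ i $ i = incl_prob p m $ i"
  by (simp add: incl_matrix_nth incl_prob_nth)

lemma incl_matrix_sym: "incl_matrix p m $ i $ j = incl_matrix p m $ j $ i"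
  by (simp add: incl_matrix_nth insert_commute)

lemma incl_matrix_Suc_Suc:
  assumes "Suc (Suc m) \<le> CARD('k)" "i \<noteq> j"
  shows "incl_matrix p (Suc (Suc m)) $ i $ j =
    odds i * odds j * esym odds (- {i, j}) m / esym odds UNIV (Suc (Suc m))"
  using prob_superset_rejective[of m "{i, j}"] assms by (simp add: incl_matrix_nth)

lemma incl_matrix_1:
  assumes "i \<noteq> j"
  shows "incl_matrix p 1 $ i $ j = 0"
proof -
  have False if "{i, j} \<subseteq> S" "S \<in> set_pmf (rejective_sampling p 1)" for S
  proof -
    have "card S = 1"
      using that by (auto simp: set_pmf_iff pmf_rejective_odds Suc_le_eq split: if_splits)
    then show False using that assms by (auto simp: card_1_singleton_iff)
  qed
  then show ?thesis
    by (auto simp: incl_matrix_nth measure_pmf_zero_iff)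
qed

lemma incl_prob_nonneg: "0 \<le> incl_prob p m $ i"
  by (simp add: incl_prob_nth)

lemma incl_prob_less_1:
  assumes "1 \<le> m" "m < CARD('k)"
  shows "incl_prob p m $ i < 1"
proof -
  obtain m' where m: "m = Suc m'" using assms by (cases m) auto
  \<comment> \<open>Because \<open>m < CARD('k)\<close>, some set of size \<open>m\<close> avoids
    \<open>i\<close>, which makes the numerator of the complementary probability positive.\<close>
  have "m \<le> card (- {i})" using assms by (simp add: card_Diff_singleton Compl_eq_Diff_UNIV)
  then have "0 < 1 - incl_prob p m $ i"
    unfolding m using assms m by (subst one_minus_incl_prob_Suc) (auto intro!: divide_pos_pos esym_odds_pos)
  then show ?thesis by simp
qed

section \<open>Negative correlation and part (b)\<close>

text \<open>Everything is expressed by the polynomials e_k of the complement of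
  \<open>{i, j}\<close>. After clearing denominators and cancelling common terms, the claim becomes
  e_k e_(k+2) \<le> e_(k+1)^2.\<close>

lemma incl_matrix_le:
  assumes "1 \<le> m" "m \<le> CARD('k)" "i \<noteq> j"
  shows "incl_matrix p m $ i $ j \<le> incl_prob p m $ i * incl_prob p m $ j"
proof (cases "m = 1")
  case True
  then show ?thesis using assms by (simp add: incl_matrix_1[simplified] incl_prob_nonneg)
next
  case False
  then obtain k where m: "m = Suc (Suc k)" using assms
    by (metis One_nat_def Suc_le_D not_less_eq_eq le_antisym)
  let ?e = "esym odds (- {i, j})" and ?E = "esym odds UNIV m"
  have E: "0 < ?E" using assms by (intro esym_odds_pos) simp
  have ij: "- {i} - {j} = - {i, j}" "- {j} - {i} = - {i, j}" by auto
  have ei: "esym odds (- {i}) (Suc l) = ?e (Suc l) + odds j * ?e l" for l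
    using esym_remove[of "- {i}" j odds l] assms ij by simp
  have ej: "esym odds (- {j}) (Suc l) = ?e (Suc l) + odds i * ?e l" for l
    using esym_remove[of "- {j}" i odds l] assms ij by simp
  have EE: "?E = esym odds (- {i}) (Suc (Suc k)) + odds i * esym odds (- {i}) (Suc k)"
    using esym_remove[of UNIV i odds "Suc k"] by (simp add: m Compl_eq_Diff_UNIV)
  have "?e k * ?e (Suc (Suc k)) \<le> ?e (Suc k) * ?e (Suc k)"
    using odds_pos by (intro esym_log_concave) (auto intro: less_imp_le)
  then have "?e k * ?E \<le> esym odds (- {i}) (Suc k) * esym odds (- {j}) (Suc k)"
    unfolding EE ei ej by (simp add: algebra_simps)
  then have "odds i * odds j * (?e k * ?E) \<le>
      odds i * odds j * (esym odds (- {i}) (Suc k) * esym odds (- {j}) (Suc k))"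
    using odds_pos by (intro mult_left_mono) (auto intro: less_imp_le)
  then have "odds i * odds j * ?e k / ?E \<le>
      (odds i * esym odds (- {i}) (Suc k) / ?E) * (odds j * esym odds (- {j}) (Suc k) / ?E)"
    using E by (simp add: field_simps)
  then show ?thesis
    using assms m by (simp add: incl_matrix_Suc_Suc incl_prob_Suc)
qed

text \<open>Double counting: every sampled set has exactly \<open>m\<close> elements. Taking
  \<open>P\<close> to be true, respectively \<open>i \<in> S\<close>, gives the sum of the inclusion
  probabilities and the row sums of \<open>incl_matrix\<close>.\<close>

lemma sum_prob_mem_rejective:
  assumes "m \<le> CARD('k)"
  shows "(\<Sum>j\<in>UNIV. measure_pmf.prob (rejective_sampling p m) {S. P S \<and> j \<in> S}) =
    real m * measure_pmf.prob (rejective_sampling p m) {S. P S}"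
proof -
  let ?r = "pmf (rejective_sampling p m)"
  have prob: "measure_pmf.prob (rejective_sampling p m) {S. Q S} = (\<Sum>S\<in>UNIV. if Q S then ?r S else 0)" for Q
    by (simp add: measure_measure_pmf_finite sum.If_cases)
  have "(\<Sum>j\<in>UNIV. \<Sum>S\<in>UNIV. if P S \<and> j \<in> S then ?r S else 0) =
      (\<Sum>S\<in>UNIV. if P S then real (card S) * ?r S else 0)"
  proof (subst sum.swap, intro sum.cong refl)
    show "(\<Sum>j\<in>UNIV. if P S \<and> j \<in> S then ?r S else 0) = (if P S then real (card S) * ?r S else 0)" for S
      by (cases "P S") (simp_all add: sum.If_cases)
  qed
  also have "\<dots> = real m * (\<Sum>S\<in>UNIV. if P S then ?r S else 0)"
    unfolding sum_distrib_left
    by (intro sum.cong refl) (simp add: pmf_rejective_odds[OF assms])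
  finally show ?thesis unfolding prob .
qed

lemma incl_matrix_loewner_le:
  assumes "1 \<le> n" "n \<le> CARD('k)"
  shows "incl_matrix p n \<preceq> outer (incl_prob p n) (incl_prob p n) + 2 *\<^sub>R diag_mat (incl_prob p n)"
  unfolding loewner_le_def
proof (rule pos_semidef_diag_dominant)
  let ?\<pi> = "incl_prob p n" and ?\<Sigma> = "incl_matrix p n"
  let ?M = "outer ?\<pi> ?\<pi> + 2 *\<^sub>R diag_mat ?\<pi> - ?\<Sigma>"
  show "?M $ i $ j = ?M $ j $ i" for i j
    by (simp add: outer_def diag_mat_def incl_matrix_sym[of n i j])
  fix i
  have \<pi>: "?\<pi> $ i \<le> 1" by (simp add: incl_prob_nth)
  \<comment> \<open>Both terms sum to \<open>n\<close> times \<open>?\<pi> $ i\<close>.\<close>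
  have "(\<Sum>j\<in>UNIV. ?\<pi> $ i * ?\<pi> $ j - ?\<Sigma> $ i $ j) = 0"
    using sum_prob_mem_rejective[OF assms(2), of "\<lambda>_. True"]
      sum_prob_mem_rejective[OF assms(2), of "\<lambda>S. i \<in> S"]
    by (simp add: incl_matrix_nth incl_prob_nth sum_subtractf sum_distrib_left[symmetric])
  then have "(\<Sum>j\<in>UNIV - {i}. ?\<pi> $ i * ?\<pi> $ j - ?\<Sigma> $ i $ j) = ?\<pi> $ i - ?\<pi> $ i * ?\<pi> $ i"
    by (simp add: sum_diff1 incl_matrix_diag)
  \<comment> \<open>Negative correlation makes the off-diagonal entries nonnegative, so the absolute
    values drop.\<close>
  moreover have "(\<Sum>j\<in>UNIV - {i}. \<bar>?M $ i $ j\<bar>) = (\<Sum>j\<in>UNIV - {i}. ?\<pi> $ i * ?\<pi> $ j - ?\<Sigma> $ i $ j)"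
    using incl_matrix_le[OF assms] by (intro sum.cong refl) (auto simp: outer_def diag_mat_def)
  \<comment> \<open>The diagonal entry is \<pi>_i^2 + \<pi>_i, while the row sum is \<pi>_i -
    \<pi>_i^2.\<close>
  ultimately show "(\<Sum>j\<in>UNIV - {i}. \<bar>?M $ i $ j\<bar>) \<le> ?M $ i $ i"
    using incl_prob_nonneg[of n i] by (simp add: outer_def diag_mat_def incl_matrix_diag)
qed

section \<open>Part (c)\<close>

text \<open>First the quotient is bounded by one factor e_(n-1) / e_n for each element of
  \<open>L\<close>. Then, in the factor belonging to \<open>l\<close>, both polynomials are replaced
  by those of \<open>- {l}\<close>, which increases the ratio. Multiplied by \<open>odds l\<close>,
  the new ratio is exactly the odds of inclusion of \<open>l\<close>.\<close>

lemma odds_esym_ratio_le: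
  assumes "1 \<le> n" "n < CARD('k)" "card L \<le> n"
  shows "prod odds L * esym odds UNIV (n - card L) / esym odds UNIV n \<le>
    (\<Prod>l\<in>L. incl_prob p n $ l / (1 - incl_prob p n $ l))"
proof -
  let ?e = "esym odds UNIV"
  obtain m where m: "n = Suc m" using assms by (cases n) auto
  have e: "0 < ?e n" "0 < ?e m"
    using assms m by (auto intro!: esym_odds_pos)
  have "prod odds L * (?e (n - card L) / ?e n) \<le> prod odds L * (?e m / ?e n) ^ card L"
    using esym_ratio_power[of UNIV odds "card L" n] assms odds_pos m
    by (intro mult_left_mono prod_nonneg) (auto intro: less_imp_le)
  also have "\<dots> = (\<Prod>l\<in>L. odds l * (?e m / ?e n))"
    by (simp only: prod.distrib prod_constant)
  also have "\<dots> \<le> (\<Prod>l\<in>L. incl_prob p n $ l / (1 - incl_prob p n $ l))"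
  proof (intro prod_mono conjI)
    fix l
    have e': "0 < esym odds (- {l}) n"
      using assms by (intro esym_odds_pos) (simp add: card_Diff_singleton Compl_eq_Diff_UNIV)
    have "?e m * esym odds (- {l}) n \<le> esym odds (- {l}) m * ?e n"
      using esym_ratio_remove[of UNIV odds l m] odds_pos
      by (simp add: m Compl_eq_Diff_UNIV less_imp_le)
    then have "?e m / ?e n \<le> esym odds (- {l}) m / esym odds (- {l}) n"
      using e e' by (simp add: field_simps)
    then have "odds l * (?e m / ?e n) \<le> odds l * (esym odds (- {l}) m / esym odds (- {l}) n)"
      using odds_pos by (intro mult_left_mono) (auto intro: less_imp_le)
    also have "\<dots> = incl_prob p n $ l / (1 - incl_prob p n $ l)"
    proof -
      have "1 - incl_prob p n $ l = esym odds (- {l}) n / ?e n"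
        unfolding m using assms m by (intro one_minus_incl_prob_Suc) simp
      moreover have "incl_prob p n $ l = odds l * esym odds (- {l}) m / ?e n"
        unfolding m using assms m by (intro incl_prob_Suc) simp
      ultimately show ?thesis using e by simp
    qed
    finally show "odds l * (?e m / ?e n) \<le> incl_prob p n $ l / (1 - incl_prob p n $ l)" .
    show "0 \<le> odds l * (?e m / ?e n)"
      using e odds_pos[of l] by simp
  qed
  finally show ?thesis by simp
qed

lemma conditional_incl_matrix_loewner_le:
  assumes "1 \<le> n" "n < CARD('k)" "card L < n"
  shows "measure_pmf.expectation (rejective_sampling p n)
      (\<lambda>S. indicator {I. L \<subseteq> I} S *\<^sub>R outer (indvec (S - L)) (indvec (S - L)))
    \<preceq> (\<Prod>l\<in>L. incl_prob p n $ l / (1 - incl_prob p n $ l)) *\<^sub>R incl_matrix p (n - card L)"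
proof -
  define m where "m = n - card L"
  have n: "n = m + card L" using assms by (simp add: m_def)
  have mK: "m \<le> CARD('k)" using assms by (simp add: m_def)
  let ?e = "esym odds UNIV" and ?P = "\<Prod>l\<in>L. incl_prob p n $ l / (1 - incl_prob p n $ l)"
  let ?O = "\<lambda>T::'k set. outer (indvec T) (indvec T)"
  let ?F = "{T::'k set. card T = m}" and ?G = "{T. T \<subseteq> - L \<and> card T = m}"
  let ?c = "prod odds L / ?e n"
  have e: "0 < ?e m" "0 < ?e n" using assms mK by (auto intro!: esym_odds_pos)
  have c_le: "?c \<le> ?P / ?e m"
    using odds_esym_ratio_le[of n L] assms e by (simp add: m_def[symmetric] field_simps)
  \<comment> \<open>Combined with \<open>c_le\<close>, this also makes the coefficient
    \<open>?P / ?e m\<close> nonnegative.\<close>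
  have c_nonneg: "0 \<le> ?c"
    using e odds_pos by (intro divide_nonneg_pos prod_nonneg) (auto intro: less_imp_le)
  have "measure_pmf.expectation (rejective_sampling p n)
      (\<lambda>S. indicator {I. L \<subseteq> I} S *\<^sub>R outer (indvec (S - L)) (indvec (S - L))) =
      ?c *\<^sub>R (\<Sum>T\<in>?G. prod odds T *\<^sub>R outer (indvec (T \<union> L - L)) (indvec (T \<union> L - L)))"
    unfolding n using assms n by (intro expectation_rejective_superset) simp
  also have "(\<Sum>T\<in>?G. prod odds T *\<^sub>R outer (indvec (T \<union> L - L)) (indvec (T \<union> L - L))) =
      (\<Sum>T\<in>?G. prod odds T *\<^sub>R ?O T)"
  proof (intro sum.cong refl)
    fix T assume "T \<in> ?G"
    then have "T \<union> L - L = T" by auto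
    then show "prod odds T *\<^sub>R outer (indvec (T \<union> L - L)) (indvec (T \<union> L - L)) = prod odds T *\<^sub>R ?O T"
      by simp
  qed
  finally have lhs: "measure_pmf.expectation (rejective_sampling p n)
      (\<lambda>S. indicator {I. L \<subseteq> I} S *\<^sub>R outer (indvec (S - L)) (indvec (S - L))) =
      ?c *\<^sub>R (\<Sum>T\<in>?G. prod odds T *\<^sub>R ?O T)" .
  have rhs: "?P *\<^sub>R incl_matrix p m = (?P / ?e m) *\<^sub>R (\<Sum>T\<in>?F. prod odds T *\<^sub>R ?O T)"
    using mK by (simp add: incl_matrix_def expectation_rejective)
  have split: "(\<Sum>T\<in>?F. prod odds T *\<^sub>R ?O T) =
      (\<Sum>T\<in>?F - ?G. prod odds T *\<^sub>R ?O T) + (\<Sum>T\<in>?G. prod odds T *\<^sub>R ?O T)"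
    by (intro sum.subset_diff) auto
  \<comment> \<open>Sets that meet \<open>L\<close> occur only on the right-hand side of the claim.
    Those disjoint from \<open>L\<close> occur on both sides, with the larger coefficient on the
    right. The difference is thus a nonnegative combination of outer products.\<close>
  have "(?P / ?e m) *\<^sub>R (\<Sum>T\<in>?F. prod odds T *\<^sub>R ?O T) - ?c *\<^sub>R (\<Sum>T\<in>?G. prod odds T *\<^sub>R ?O T) =
      (?P / ?e m) *\<^sub>R (\<Sum>T\<in>?F - ?G. prod odds T *\<^sub>R ?O T) +
      (?P / ?e m - ?c) *\<^sub>R (\<Sum>T\<in>?G. prod odds T *\<^sub>R ?O T)"
    unfolding split by (simp only: scaleR_add_right scaleR_diff_left add_diff_eq)
  moreover have "pos_semidef \<dots>"
    using c_le c_nonneg odds_pos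
    by (intro pos_semidef_add pos_semidef_scaleR pos_semidef_sum pos_semidef_outer prod_nonneg)
       (auto intro: less_imp_le)
  ultimately show ?thesis
    unfolding loewner_le_def m_def[symmetric] lhs rhs by simp
qed

section \<open>Part (a)\<close>

text \<open>
  The Gram matrix is indexed by \<open>{T. card T + 2 = n}\<close> rather than \<open>{T. card T = n - 2}\<close>, because
  the latter is nonempty for \<open>n = 1\<close>, where the off-diagonal entries vanish.
\<close>

lemma opnorm_hadamard_incl_matrix_le:
  assumes "1 \<le> n" "n < CARD('k)"
    and A0: "\<And>i. A $ i $ i = 0" and M: "\<And>i. incl_prob p n $ i \<le> M" "M < 1"
  shows "opnorm (A \<odot> incl_matrix p n) \<le>
    1 / (1 - M) * opnorm (diag_mat (incl_prob p n) ** A ** diag_mat (incl_prob p n))"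
proof -
  let ?\<pi> = "incl_prob p n" and ?E = "esym odds UNIV n"
  define F :: "'k set set" where "F = {T. card T + 2 = n}"
  define w where "w T = prod odds T / ?E" for T
  \<comment> \<open>Division by \<open>?\<pi> $ i\<close> compensates the factors that the two
    diagonal matrices put around \<open>A\<close>.\<close>
  define a :: "'k set \<Rightarrow> real ^ 'k" where "a T = (\<chi> i. if i \<in> T then 0 else odds i / ?\<pi> $ i)" for T
  obtain m where m: "n = Suc m" using assms by (cases n) auto
  have E: "0 < ?E" using assms by (intro esym_odds_pos) simp
  have e: "0 < esym odds (- {i}) m" "0 < esym odds (- {i}) n" for i
    using assms m by (auto intro!: esym_odds_pos simp: card_Diff_singleton Compl_eq_Diff_UNIV)
  have \<pi>: "?\<pi> $ i = odds i * esym odds (- {i}) m / ?E" for i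
    unfolding m using assms m by (intro incl_prob_Suc) simp
  have \<pi>_pos: "0 < ?\<pi> $ i" for i
    unfolding \<pi> using E e odds_pos by simp
  have M0: "0 \<le> 1 / (1 - M)" using M by simp
  have B: "(diag_mat ?\<pi> ** A ** diag_mat ?\<pi>) $ i $ j = ?\<pi> $ i * A $ i $ j * ?\<pi> $ j" for i j
    by (simp add: matrix_matrix_mult_def diag_mat_def if_distrib[of "\<lambda>x. x * _"]
        if_distrib[of "\<lambda>x. _ * x"] cong: if_cong)
  \<comment> \<open>Only the \<open>T\<close> that avoid both indices contribute. The case
    \<open>i = j\<close> is included: it gives the diagonal, on which the Schur bound
    depends.\<close>
  have gram: "(\<Sum>T\<in>F. w T * (a T $ i * a T $ j)) =
      odds i * odds j / (?\<pi> $ i * ?\<pi> $ j) * (\<Sum>T | T \<subseteq> - {i, j} \<and> card T + 2 = n. prod odds T) / ?E" for i j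
  proof -
    have "(\<Sum>T\<in>F. w T * (a T $ i * a T $ j)) =
        (\<Sum>T | T \<subseteq> - {i, j} \<and> card T + 2 = n. w T * (odds i / ?\<pi> $ i * (odds j / ?\<pi> $ j)))"
      by (intro sum.mono_neutral_cong_right) (auto simp: F_def a_def)
    then show ?thesis
      by (simp add: w_def sum_distrib_left sum_distrib_right sum_divide_distrib mult_ac)
  qed
  have eq: "A \<odot> incl_matrix p n =
      (diag_mat ?\<pi> ** A ** diag_mat ?\<pi>) \<odot> (\<Sum>T\<in>F. w T *\<^sub>R outer (a T) (a T))"
  proof -
    have "A $ i $ j * incl_matrix p n $ i $ j =
        ?\<pi> $ i * A $ i $ j * ?\<pi> $ j * (\<Sum>T\<in>F. w T * (a T $ i * a T $ j))" for i j
    proof (cases "i = j")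
      \<comment> \<open>The Gram matrix need not match on the diagonal; \<open>A\<close> vanishes
        there.\<close>
      case True
      then show ?thesis using A0 by simp
    next
      case ij: False
      show ?thesis
      proof (cases m)
        case 0
        then show ?thesis using ij m by (simp add: F_def incl_matrix_1[simplified])
      next
        case (Suc k)
        have "incl_matrix p n $ i $ j = odds i * odds j * esym odds (- {i, j}) k / ?E"
          unfolding m Suc using assms m Suc ij by (intro incl_matrix_Suc_Suc) auto
        moreover have "(\<Sum>T | T \<subseteq> - {i, j} \<and> card T + 2 = n. prod odds T) = esym odds (- {i, j}) k"
          by (simp add: esym_def m Suc)
        ultimately show ?thesis
          using \<pi>_pos[of i] \<pi>_pos[of j] unfolding gram by simp
      qed
    qed
    then show ?thesis
      by (simp add: vec_eq_iff hadamard_def B outer_def)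
  qed
  have bound: "(\<Sum>T\<in>F. w T * (a T $ i)\<^sup>2) \<le> 1 / (1 - M)" for i
  proof (cases m)
    case 0
    then show ?thesis using M0 m by (simp add: F_def)
  next
    case (Suc k)
    let ?e = "esym odds (- {i})"
    have En: "?E = ?e n + odds i * ?e m"
      using esym_remove[of UNIV i odds m] by (simp add: m Compl_eq_Diff_UNIV)
    have ek: "0 \<le> ?e k" by (rule esym_odds_nonneg)
    have lc: "?e k * ?e n \<le> ?e m * ?e m"
      using esym_log_concave[of "- {i}" odds k m] odds_pos by (simp add: m Suc less_imp_le)
    have "(\<Sum>T\<in>F. w T * (a T $ i)\<^sup>2) = odds i * odds i / (?\<pi> $ i * ?\<pi> $ i) * ?e k / ?E"
      using gram[of i i] by (simp add: power2_eq_square esym_def m Suc)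
    also have "\<dots> = ?e k * ?E / (?e m * ?e m)"
      using E e[of i] odds_pos[of i] by (simp add: \<pi> field_simps)
    \<comment> \<open>Log-concavity on \<open>- {i}\<close> turns the Gram diagonal into the
      reciprocal of the probability that \<open>i\<close> is not sampled.\<close>
    also have "\<dots> \<le> ?E / ?e n"
      using lc e[of i] E by (simp add: field_simps)
    also have "\<dots> = 1 / (1 - ?\<pi> $ i)"
      using assms m by (simp add: one_minus_incl_prob_Suc)
    also have "\<dots> \<le> 1 / (1 - M)"
      using M(1)[of i] M(2) by (intro divide_left_mono) auto
    finally show ?thesis .
  qed
  show ?thesis
    unfolding eq
  proof (rule opnorm_hadamard_gram_le[OF _ M0 bound])
    show "0 \<le> w T" for T
      unfolding w_def using E odds_pos by (intro divide_nonneg_pos prod_nonneg) (auto intro: less_imp_le)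
  qed
qed

text \<open>Since \<open>incl_matrix\<close> has diagonal \<open>\<pi>\<close>, the diagonal part of
  \<open>A\<close> contributes exactly \<open>A \<odot> diag_mat \<pi>\<close>. The rest has zero
  diagonal and falls under the Schur bound.\<close>

lemma opnorm_incl_matrix_le:
  assumes "1 \<le> n" "n < CARD('k)"
  defines "\<pi> \<equiv> incl_prob p n"
  shows "opnorm (A \<odot> incl_matrix p n)
    \<le> (1 + (MAX i. \<pi> $ i)) / (1 - (MAX i. \<pi> $ i))\<^sup>2
        * opnorm (diag_mat \<pi> ** (A - A \<odot> mat 1) ** diag_mat \<pi>)
      + opnorm (A \<odot> diag_mat \<pi>)"
proof -
  define M where "M = (MAX i. \<pi> $ i)"
  let ?A0 = "A - A \<odot> mat 1"
  have M_ge: "\<pi> $ i \<le> M" for i unfolding M_def by (intro Max_ge) auto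
  \<comment> \<open>The maximum is attained, so it inherits the strict bound by 1 from a single
    coordinate.\<close>
  have "M \<in> range (($) \<pi>)" unfolding M_def by (intro Max_in) auto
  then have M: "M < 1" "0 \<le> M"
    using incl_prob_less_1[OF assms(1,2)] incl_prob_nonneg by (auto simp: \<pi>_def)
  have "A \<odot> incl_matrix p n = ?A0 \<odot> incl_matrix p n + A \<odot> diag_mat \<pi>"
    by (simp add: vec_eq_iff hadamard_def mat_def diag_mat_def \<pi>_def incl_matrix_diag)
  then have "opnorm (A \<odot> incl_matrix p n) \<le> opnorm (?A0 \<odot> incl_matrix p n) + opnorm (A \<odot> diag_mat \<pi>)"
    using opnorm_triangle by metis
  also have "opnorm (?A0 \<odot> incl_matrix p n) \<le> 1 / (1 - M) * opnorm (diag_mat \<pi> ** ?A0 ** diag_mat \<pi>)"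
    unfolding \<pi>_def using M_ge M
    by (intro opnorm_hadamard_incl_matrix_le assms) (auto simp: hadamard_def mat_def \<pi>_def)
  also have "\<dots> \<le> (1 + M) / (1 - M)\<^sup>2 * opnorm (diag_mat \<pi> ** ?A0 ** diag_mat \<pi>)"
  \<comment> \<open>The Schur bound gives the sharper constant 1 / (1 - M), weakened here by 1 - M
    \<le> 1 + M.\<close>
  proof (intro mult_right_mono opnorm_nonneg)
    have "1 / (1 - M) = (1 - M) / (1 - M)\<^sup>2"
      using M by (simp add: power2_eq_square)
    also have "\<dots> \<le> (1 + M) / (1 - M)\<^sup>2"
      using M by (intro divide_right_mono) auto
    finally show "1 / (1 - M) \<le> (1 + M) / (1 - M)\<^sup>2" .
  qed
  finally show ?thesis unfolding M_def by simp
qed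

end

theorem theorem2:
  fixes p :: "real ^ 'k::finite" and n :: nat
  defines "\<pi> \<equiv> incl_prob p n"
  assumes "\<And>i. 0 < p $ i" and "\<And>i. p $ i < 1"
    and "1 \<le> n" and "n \<le> CARD('k)"
  shows "(n < CARD('k) \<longrightarrow>
           (\<forall>A :: real ^ 'k ^ 'k.
              opnorm (A \<odot> incl_matrix p n)
                \<le> (1 + (MAX i. \<pi> $ i)) / (1 - (MAX i. \<pi> $ i))\<^sup>2
                     * opnorm (diag_mat \<pi> ** (A - A \<odot> mat 1) ** diag_mat \<pi>)
                   + opnorm (A \<odot> diag_mat \<pi>)))
    \<and> incl_matrix p n \<preceq> outer \<pi> \<pi> + 2 *\<^sub>R diag_mat \<pi>
    \<and> (n < CARD('k) \<longrightarrow>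
        (\<forall>L :: 'k set. card L < n \<longrightarrow>
           measure_pmf.expectation (rejective_sampling p n)
             (\<lambda>S. indicator {I. L \<subseteq> I} S *\<^sub>R outer (indvec (S - L)) (indvec (S - L)))
           \<preceq> (\<Prod>l\<in>L. \<pi> $ l / (1 - \<pi> $ l)) *\<^sub>R incl_matrix p (n - card L)))"
  unfolding \<pi>_def
  using opnorm_incl_matrix_le[OF assms(2,3,4)] incl_matrix_loewner_le[OF assms(2-5)]
    conditional_incl_matrix_loewner_le[OF assms(2,3,4)]
  by blast

end
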